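(* Let $n\ge 2$ be an integer and let $z\in\mathbb{C}$ with $\mathrm{Im}(z)>0$ and $|z|^2=n$. Then $z$ satisfies the periodicity condition $z^2\in\mathbb{Z}+z\mathbb{Z}$ if and only if there is an integer $D$ with $-2\sqrt n<D<2\sqrt n$ such that $$z=\frac D2+\mathrm{i}\sqrt{n-\left(\frac D2\right)^2},$$ and in that case $z^2=Dz-n$.
   Context: Here $\mathbb{Z}+z\mathbb{Z}=\{a+bz : a,b\in\mathbb{Z}\}$. *)

theory Defs
  imports Complex_Main
begin

definition Z_plus_zZ :: "complex \<Rightarrow> complex set" where
  "Z_plus_zZ z = {of_int a + of_int b * z | a b :: int. True}"

definition periodicity_condition :: "complex \<Rightarrow> bool" where
  "periodicity_condition z \<longleftrightarrow> z\<^sup>2 \<in> Z_plus_zZ z"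

end

theory Submission
  imports Defs
begin

text \<open>Both sides of the equivalence say that \<open>2 * Re z\<close> is an integer. Every
  complex z is a root of X^2 - 2 Re(z) X + |z|^2, the polynomial with roots z and its conjugate; so
  if 2 Re z = D, then z^2 = D z - n, which lies in Z + zZ
  (\<open>square_eq_if_Re_eq_half_int\<close>). Conversely, the imaginary part of z^2 = a + b z
  forces 2 Re z = b (\<open>periodicity_condition_iff\<close>). The explicit formula is Re z = D/2
  in another form (\<open>Re_eq_half_int_iff\<close>).\<close>

lemma square_eq_if_Re_eq_half_int:
  fixes n D :: int and z :: complex
  assumes "(cmod z)\<^sup>2 = of_int n" and "Re z = of_int D / 2"
  shows "z\<^sup>2 = of_int D * z - of_int n"
proof -
  have n: "real_of_int n = (Re z)\<^sup>2 + (Im z)\<^sup>2"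
    using assms(1) by (simp add: cmod_power2)
  have D: "real_of_int D = 2 * Re z"
    using assms(2) by simp
  show ?thesis
    by (simp add: complex_eq_iff n D power2_eq_square)
qed

text \<open>A point of the upper half-plane is determined by its real part and its modulus. Stated
  for a fixed \<open>D\<close>, so that it can rewrite under either quantifier.\<close>

lemma Re_eq_half_int_iff:
  fixes n D :: int and z :: complex
  assumes "Im z > 0" and "(cmod z)\<^sup>2 = of_int n"
  shows "- 2 * sqrt (of_int n) < of_int D \<and> of_int D < 2 * sqrt (of_int n) \<and>
           z = of_int D / 2 + \<i> * complex_of_real (sqrt (of_int n - (of_int D / 2)\<^sup>2))
         \<longleftrightarrow> Re z = of_int D / 2" (is "?L \<longleftrightarrow> ?R")
proof
  assume ?L
  then have "Re z = Re (of_int D / 2 + \<i> * complex_of_real (sqrt (of_int n - (of_int D / 2)\<^sup>2)))"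
    by metis
  then show ?R by simp
next
  assume R: ?R
  have n: "real_of_int n = (Re z)\<^sup>2 + (Im z)\<^sup>2"
    using assms(2) by (simp add: cmod_power2)
  then have Im: "Im z = sqrt (of_int n - (of_int D / 2)\<^sup>2)"
    using R assms(1) by simp
  \<comment> \<open>Strict because Im z is nonzero; this gives the strict bounds on
    \<open>D\<close>.\<close>
  have "(Re z)\<^sup>2 < of_int n"
    using n assms(1) by simp
  then have "\<bar>Re z\<bar> < sqrt (of_int n)"
    by (simp add: real_less_rsqrt)
  then show ?L
    using R Im by (auto simp: complex_eq_iff)
qed

lemma periodicity_condition_iff:
  fixes n :: int and z :: complex
  assumes "Im z > 0" and "(cmod z)\<^sup>2 = of_int n"
  shows "periodicity_condition z \<longleftrightarrow> (\<exists>D::int. Re z = of_int D / 2)"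
proof
  assume "periodicity_condition z"
  then obtain a b :: int where ab: "z\<^sup>2 = of_int a + of_int b * z"
    by (auto simp: periodicity_condition_def Z_plus_zZ_def)
  \<comment> \<open>Taking imaginary parts eliminates \<open>a\<close>; then Im z > 0 can be
    cancelled.\<close>
  have "2 * Re z * Im z = of_int b * Im z"
    using arg_cong[OF ab, of Im] by (simp add: power2_eq_square)
  then have "Re z = of_int b / 2"
    using assms(1) by simp
  then show "\<exists>D::int. Re z = of_int D / 2" ..
next
  assume "\<exists>D::int. Re z = of_int D / 2"
  then obtain D :: int where "Re z = of_int D / 2" ..
  then have "z\<^sup>2 = of_int (- n) + of_int D * z"
    using square_eq_if_Re_eq_half_int assms(2) by simp
  then show "periodicity_condition z"
    unfolding periodicity_condition_def Z_plus_zZ_def by blast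
qed

theorem mainTheorem5:
  fixes n :: int and z :: complex
  assumes "n \<ge> 2"
    and "Im z > 0"
    and "(cmod z)\<^sup>2 = of_int n"
  shows "(periodicity_condition z \<longleftrightarrow>
           (\<exists>D::int. - 2 * sqrt (of_int n) < of_int D \<and> of_int D < 2 * sqrt (of_int n) \<and>
              z = of_int D / 2 + \<i> * complex_of_real (sqrt (of_int n - (of_int D / 2)\<^sup>2))))
       \<and> (\<forall>D::int. - 2 * sqrt (of_int n) < of_int D \<and> of_int D < 2 * sqrt (of_int n) \<and>
              z = of_int D / 2 + \<i> * complex_of_real (sqrt (of_int n - (of_int D / 2)\<^sup>2))
            \<longrightarrow> z\<^sup>2 = of_int D * z - of_int n)"
  \<comment> \<open>This makes the two sides of the equivalence identical and leaves only the
    formula for z^2 under \<open>Re z = of_int D / 2\<close>.\<close>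
  unfolding Re_eq_half_int_iff[OF assms(2,3)] periodicity_condition_iff[OF assms(2,3)]
  using square_eq_if_Re_eq_half_int assms(3) by blast

end
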